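(* The solutions of the equation $$\left\langle\begin{pmatrix}0&1\\0&0\end{pmatrix}Y,N_Y\right\rangle=k_Y^{1/3}$$ for curves $Y$ in $\mathbb{R}^2$ are the following curves: (1) The lines $y=C$, with $C$ any constant; (2) The curves $x=\frac1{20}y^5+C_1y+C_2$, with $C_1$, $C_2$ any constants.
   Context: Points of $\mathbb{R}^2$ are written as $(x,y)$. Curves are smooth immersed curves. For a curve $Y=Y(u)$, put $T=Y_u/\|Y_u\|$, $N_Y=JT$ with $J=\begin{pmatrix}0&-1\\1&0\end{pmatrix}$ (unit normal), and $k_Y=\det(Y_u,Y_{uu})/\|Y_u\|^3$ (curvature with respect to $N_Y$). $\langle\cdot,\cdot\rangle$ is the Euclidean inner product and $k^{1/3}$ is the real (odd) cube root. Solutions are regarded as geometric curves (up to reparametrization), connected and maximally extended. *)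

theory Defs
  imports "HOL-Analysis.Analysis"
begin

text \<open>
  A parametrized curve is a function \<open>Y\<close> together with a parameter domain \<open>I\<close>, a nonempty open
  interval (bounded or not). The values of \<open>Y\<close> outside \<open>I\<close> are irrelevant.
\<close>

definition vderiv :: "(real \<Rightarrow> 'a::real_normed_vector) \<Rightarrow> real \<Rightarrow> 'a" where
  "vderiv f t = vector_derivative f (at t)"

text \<open>Smooth means infinitely differentiable; this definition is only used on open sets.\<close>

definition smooth_on :: "real set \<Rightarrow> (real \<Rightarrow> 'a::real_normed_vector) \<Rightarrow> bool" where
  "smooth_on I f \<longleftrightarrow> (\<forall>n. \<forall>t\<in>I. ((vderiv ^^ n) f) differentiable (at t))"

definition immersed_curve :: "real set \<Rightarrow> (real \<Rightarrow> real^2) \<Rightarrow> bool" where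
  "immersed_curve I Y \<longleftrightarrow>
     I \<noteq> {} \<and> open I \<and> connected I \<and> smooth_on I Y \<and> (\<forall>u\<in>I. vderiv Y u \<noteq> 0)"

definition unit_tangent :: "(real \<Rightarrow> real^2) \<Rightarrow> real \<Rightarrow> real^2" where
  "unit_tangent Y u = vderiv Y u /\<^sub>R norm (vderiv Y u)"

definition J_mat :: "real^2^2" where
  "J_mat = vector [vector [0, -1], vector [1, 0]]"

definition unit_normal :: "(real \<Rightarrow> real^2) \<Rightarrow> real \<Rightarrow> real^2" where
  "unit_normal Y u = J_mat *v unit_tangent Y u"

text \<open>Transposing makes the two derivative vectors the columns of the matrix.\<close>

definition curvature :: "(real \<Rightarrow> real^2) \<Rightarrow> real \<Rightarrow> real" where
  "curvature Y u =
     det (transpose (vector [vderiv Y u, vderiv (vderiv Y) u] :: real^2^2)) / norm (vderiv Y u) ^ 3"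

definition shear_mat :: "real^2^2" where
  "shear_mat = vector [vector [0, 1], vector [0, 0]]"

text \<open>\<^term>\<open>root 3\<close> is the odd cube root on all of the reals.\<close>

definition solution :: "real set \<Rightarrow> (real \<Rightarrow> real^2) \<Rightarrow> bool" where
  "solution I Y \<longleftrightarrow> immersed_curve I Y \<and>
     (\<forall>u\<in>I. (shear_mat *v Y u) \<bullet> unit_normal Y u = root 3 (curvature Y u))"

text \<open>
  The change of parameter \<open>\<phi>\<close> identifies the curve \<open>Y\<close> on \<open>I\<close> with the restriction of \<open>Z\<close> to the
  open subinterval \<open>\<phi> ` I\<close> of \<open>K\<close>. Orientation reversal is allowed.
\<close>

definition curve_embedding ::
    "(real \<Rightarrow> real) \<Rightarrow> real set \<Rightarrow> (real \<Rightarrow> real^2) \<Rightarrow> real set \<Rightarrow> (real \<Rightarrow> real^2) \<Rightarrow> bool" where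
  "curve_embedding \<phi> I Y K Z \<longleftrightarrow>
     immersed_curve I Y \<and> immersed_curve K Z \<and>
     smooth_on I \<phi> \<and> (\<forall>u\<in>I. vderiv \<phi> u \<noteq> 0) \<and> inj_on \<phi> I \<and> \<phi> ` I \<subseteq> K \<and>
     (\<forall>u\<in>I. Y u = Z (\<phi> u))"

definition reparametrization ::
    "real set \<Rightarrow> (real \<Rightarrow> real^2) \<Rightarrow> real set \<Rightarrow> (real \<Rightarrow> real^2) \<Rightarrow> bool" where
  "reparametrization I Y K Z \<longleftrightarrow> (\<exists>\<phi>. curve_embedding \<phi> I Y K Z \<and> \<phi> ` I = K)"

text \<open>
  Maximality is that of the geometric curve: no solution, in any parametrization, properly
  extends it. Comparing only \<open>I \<subseteq> K\<close> with \<open>Y = Z\<close> on \<open>I\<close> would wrongly count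
  a half-line parametrized over all of the reals as maximal.
\<close>

definition maximal_solution :: "real set \<Rightarrow> (real \<Rightarrow> real^2) \<Rightarrow> bool" where
  "maximal_solution I Y \<longleftrightarrow> solution I Y \<and>
     (\<forall>K Z \<phi>. solution K Z \<and> curve_embedding \<phi> I Y K Z \<longrightarrow> \<phi> ` I = K)"

text \<open>The curves \<open>y = C\<close> and \<open>x = y^5/20 + C1 y + C2\<close>, parametrized as graphs over all of the reals.\<close>

definition horizontal_line :: "real \<Rightarrow> real \<Rightarrow> real^2" where
  "horizontal_line C s = vector [s, C]"

definition quintic_curve :: "real \<Rightarrow> real \<Rightarrow> real \<Rightarrow> real^2" where
  "quintic_curve C1 C2 s = vector [1/20 * s^5 + C1 * s + C2, s]"

lemma range_horizontal_line: "range (horizontal_line C) = {p. p $ 2 = C}"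
proof -
  have "p \<in> range (horizontal_line C)" if "p $ 2 = C" for p
    by (rule range_eqI[of _ _ "p $ 1"]) (simp add: horizontal_line_def vec_eq_iff forall_2 that)
  then show ?thesis
    by (auto simp: horizontal_line_def)
qed

lemma range_quintic_curve:
  "range (quintic_curve C1 C2) = {p. p $ 1 = 1/20 * (p $ 2)^5 + C1 * p $ 2 + C2}"
proof -
  have "p \<in> range (quintic_curve C1 C2)" if "p $ 1 = 1/20 * (p $ 2)^5 + C1 * p $ 2 + C2" for p
    by (rule range_eqI[of _ _ "p $ 2"]) (simp add: quintic_curve_def vec_eq_iff forall_2 that)
  then show ?thesis
    by (auto simp: quintic_curve_def)
qed

end

theory Submission
  imports Defs "HOL-Computational_Algebra.Polynomial"
begin

text \<open>
  Write \<open>Y = (x, y)\<close>. After clearing the speed and the cube root, the equation reads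
  \<open>x'' y' - x' y'' = (y y')\<^sup>3\<close> in any parametrization (\<open>solution_iff_ode\<close>). Where \<open>y' \<noteq> 0\<close> it
  says that \<open>x'/y' - y\<^sup>4/4\<close> has derivative zero, so
  \<open>x' = (y\<^sup>4/4 + C\<^sub>1) y'\<close> near any such point. This relation forces \<open>y' \<noteq> 0\<close> wherever it holds, because
  \<open>x'\<close> and \<open>y'\<close> cannot both vanish on an immersed curve; hence it cannot break down at a boundary
  point of its domain of validity and, by connectedness, it holds on the whole curve
  (\<open>slope_ode_dichotomy\<close>). So either \<open>y' = 0\<close> throughout, and the curve lies on a horizontal line, or
  one more integration puts it on a quintic. Conversely, immersed curves lying on these sets solve
  the equation (\<open>solution_iff_line_or_quintic\<close>).

  What remains is the description of the maximal solutions. On an immersed curve in a horizontal line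
  the coordinate \<open>x\<close> has nonvanishing derivative, and on one in a quintic the coordinate \<open>y\<close> has.
  This coordinate is thus an injective change of parameter that embeds the curve into the full line or
  the full quintic, and a maximal solution must fill it. In the other direction, on a
  curve that covers the line or the quintic this coordinate already takes all real values. A larger
  solution is then of the same kind, since a line and a quintic meet in a single point, and
  injectivity of the same coordinate on it leaves no room for further parameters.
\<close>

section \<open>Smooth functions and their coordinates\<close>

lemma vderiv_eqI: "(f has_vector_derivative D) (at t) \<Longrightarrow> vderiv f t = D"
  by (simp add: vderiv_def vector_derivative_at)

lemma smooth_on_vderivs:
  assumes "smooth_on I f" "t \<in> I"
  shows "((vderiv ^^ n) f has_vector_derivative (vderiv ^^ Suc n) f t) (at t)"
  using assms by (simp add: smooth_on_def vderiv_def vector_derivative_works[symmetric])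

text \<open>
  Iterated derivatives refer to values at neighbouring parameters, so the identity of the \<open>n\<close>-th
  derivatives on the open set \<open>I\<close> is needed to pass to the next one. The induction therefore carries
  both that identity and the derivative it leads to.
\<close>

lemma smooth_on_coordinate:
  fixes Y :: "real \<Rightarrow> real^'n"
  assumes "open I" "smooth_on I Y"
  shows "smooth_on I (\<lambda>u. Y u $ i)"
proof -
  have eq: "\<forall>t\<in>I. (vderiv ^^ n) (\<lambda>u. Y u $ i) t = (vderiv ^^ n) Y t $ i"
    and deriv: "\<forall>t\<in>I. ((vderiv ^^ n) (\<lambda>u. Y u $ i) has_vector_derivative (vderiv ^^ Suc n) Y t $ i) (at t)" for n
  proof (induction n)
    case 0
    { case 1 show ?case by simp }
    { case 2 show ?case
        using smooth_on_vderivs[OF assms(2), of _ 0]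
        by (auto intro: bounded_linear.has_vector_derivative[OF bounded_linear_vec_nth]) }
  next
    case (Suc n)
    { case 1 show ?case using Suc(2) by (auto intro: vderiv_eqI) }
    note eq = this
    { case 2 show ?case
      proof
        fix t assume t: "t \<in> I"
        have "((\<lambda>u. (vderiv ^^ Suc n) Y u $ i) has_vector_derivative (vderiv ^^ Suc (Suc n)) Y t $ i) (at t)"
          using smooth_on_vderivs[OF assms(2) t, of "Suc n"]
          by (rule bounded_linear.has_vector_derivative[OF bounded_linear_vec_nth])
        then show "((vderiv ^^ Suc n) (\<lambda>u. Y u $ i) has_vector_derivative (vderiv ^^ Suc (Suc n)) Y t $ i) (at t)"
          by (rule has_vector_derivative_transform_within_open[OF _ assms(1) t]) (use eq in auto)
      qed }
  qed
  then show ?thesis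
    unfolding smooth_on_def by (meson differentiableI_vector)
qed

lemma smooth_coordinate_derivs:
  fixes Y :: "real \<Rightarrow> real^'n"
  assumes "smooth_on I Y" "t \<in> I"
  shows "((\<lambda>u. Y u $ i) has_real_derivative vderiv Y t $ i) (at t)"
    and "((\<lambda>u. vderiv Y u $ i) has_real_derivative vderiv (vderiv Y) t $ i) (at t)"
  unfolding has_real_derivative_iff_has_vector_derivative
  using smooth_on_vderivs[OF assms, of 0] smooth_on_vderivs[OF assms, of 1]
  by (auto intro!: bounded_linear.has_vector_derivative[OF bounded_linear_vec_nth])

lemma has_vector_derivative_planar_poly:
  "((\<lambda>s. vector [poly p s, poly q s] :: real^2) has_vector_derivative
     vector [poly (pderiv p) t, poly (pderiv q) t]) (at t)"
proof -
  have *: "vector [a, b] = a *\<^sub>R axis 1 1 + b *\<^sub>R (axis 2 1 :: real^2)" for a b :: real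
    by (simp add: vec_eq_iff forall_2 axis_def)
  show ?thesis
    unfolding * by (auto intro!: derivative_eq_intros poly_DERIV)
qed

text \<open>
  The lines and quintics are polynomial curves, and polynomial curves are closed under
  differentiation, which gives all iterated derivatives at once.
\<close>

lemma smooth_on_planar_poly: "smooth_on I (\<lambda>s. vector [poly p s, poly q s] :: real^2)"
proof -
  have "(vderiv ^^ n) (\<lambda>s. vector [poly p s, poly q s] :: real^2)
      = (\<lambda>s. vector [poly ((pderiv ^^ n) p) s, poly ((pderiv ^^ n) q) s])" for n
    by (induction n) (auto intro!: vderiv_eqI has_vector_derivative_planar_poly)
  then show ?thesis
    unfolding smooth_on_def using differentiableI_vector[OF has_vector_derivative_planar_poly]
    by simp
qed

lemma inj_on_nonzero_deriv:
  fixes f :: "real \<Rightarrow> real"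
  assumes "connected I"
    and deriv: "\<And>t. t \<in> I \<Longrightarrow> (f has_real_derivative f' t) (at t)"
    and nz: "\<And>t. t \<in> I \<Longrightarrow> f' t \<noteq> 0"
  shows "inj_on f I"
proof (rule linorder_inj_onI)
  fix a b assume ab: "a < b" "a \<in> I" "b \<in> I"
  then have sub: "{a..b} \<subseteq> I"
    using assms(1) connected_contains_Icc by blast
  obtain z where "a < z" "z < b" "f b - f a = (b - a) * f' z"
    using MVT2[of a b f f'] ab(1) deriv sub by (metis atLeastAtMost_iff subsetD)
  moreover from this have "z \<in> I"
    using sub by auto
  ultimately show "f a \<noteq> f b"
    using nz[of z] ab(1) by auto
qed auto

lemma zero_deriv_constant:
  fixes f :: "real \<Rightarrow> real"
  assumes "open I" "connected I"
    and "\<And>t. t \<in> I \<Longrightarrow> (f has_real_derivative 0) (at t)"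
  shows "\<exists>c. \<forall>t\<in>I. f t = c"
proof -
  have "continuous_on I f"
    using assms(3) by (meson DERIV_continuous_on has_field_derivative_at_within)
  then obtain c where "\<And>t. t \<in> I \<Longrightarrow> f t = c"
    using DERIV_zero_connected_constant[OF assms(2,1) finite.emptyI] assms(3) by auto
  then show ?thesis
    by blast
qed

section \<open>The equation in coordinates\<close>

lemma immersed_coordinates_nonzero:
  assumes "immersed_curve I Y" "u \<in> I"
  shows "vderiv Y u $ 1 \<noteq> 0 \<or> vderiv Y u $ 2 \<noteq> 0"
  using assms by (auto simp: immersed_curve_def vec_eq_iff forall_2)

text \<open>
  Both sides of the equation carry the factor \<open>1 / norm (vderiv Y u)\<close>, on the right because the
  cube root undoes the cube in the curvature. What is left is free of roots and norms.
\<close>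

lemma solution_iff_ode:
  "solution I Y \<longleftrightarrow> immersed_curve I Y \<and>
     (\<forall>u\<in>I. vderiv (vderiv Y) u $ 1 * vderiv Y u $ 2 - vderiv Y u $ 1 * vderiv (vderiv Y) u $ 2
          = (Y u $ 2 * vderiv Y u $ 2) ^ 3)"
proof -
  have "(shear_mat *v Y u) \<bullet> unit_normal Y u = root 3 (curvature Y u) \<longleftrightarrow>
      vderiv (vderiv Y) u $ 1 * vderiv Y u $ 2 - vderiv Y u $ 1 * vderiv (vderiv Y) u $ 2
          = (Y u $ 2 * vderiv Y u $ 2) ^ 3" (is "?eqn \<longleftrightarrow> ?ode")
    if "immersed_curve I Y" "u \<in> I" for u
  proof -
    define v where "v = norm (vderiv Y u)"
    define a where "a = Y u $ 2 * vderiv Y u $ 2"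
    define d where "d = vderiv Y u $ 1 * vderiv (vderiv Y) u $ 2 - vderiv (vderiv Y) u $ 1 * vderiv Y u $ 2"
    have v: "v > 0"
      using that by (simp add: v_def immersed_curve_def)
    have lhs: "(shear_mat *v Y u) \<bullet> unit_normal Y u = - a / v"
      by (simp add: inner_vec_def sum_2 shear_mat_def unit_normal_def J_mat_def unit_tangent_def
          matrix_vector_mult_def a_def v_def divide_inverse)
    have "curvature Y u = d / v ^ 3"
      by (simp add: curvature_def det_2 transpose_def d_def v_def)
    then have rhs: "root 3 (curvature Y u) = root 3 d / v"
      by (simp add: real_root_divide odd_real_root_power_cancel)
    have "?eqn \<longleftrightarrow> root 3 d = - a"
      unfolding lhs rhs using v by (auto simp: field_simps)
    also have "\<dots> \<longleftrightarrow> d = (- a) ^ 3"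
      by (metis numeral_3_eq_3 odd_numeral odd_real_root_pow odd_real_root_power_cancel)
    also have "\<dots> \<longleftrightarrow> ?ode"
      by (auto simp: d_def a_def)
    finally show ?thesis .
  qed
  then show ?thesis
    unfolding solution_def by blast
qed

text \<open>
  The set of parameters where \<open>x' = (y\<^sup>4/4 + C) y'\<close> is closed by continuity. It is open because the
  relation keeps \<open>y'\<close> away from zero, so that the quotient \<open>x'/y' - y\<^sup>4/4\<close> makes sense nearby, and by
  the equation this quotient is locally constant.
\<close>

lemma slope_ode_dichotomy:
  fixes y x' y' x'' y'' :: "real \<Rightarrow> real"
  assumes I: "open I" "connected I"
    and dy: "\<And>u. u \<in> I \<Longrightarrow> (y has_real_derivative y' u) (at u)"
    and dx': "\<And>u. u \<in> I \<Longrightarrow> (x' has_real_derivative x'' u) (at u)"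
    and dy': "\<And>u. u \<in> I \<Longrightarrow> (y' has_real_derivative y'' u) (at u)"
    and regular: "\<And>u. u \<in> I \<Longrightarrow> x' u \<noteq> 0 \<or> y' u \<noteq> 0"
    and ode: "\<And>u. u \<in> I \<Longrightarrow> x'' u * y' u - x' u * y'' u = (y u * y' u) ^ 3"
  shows "(\<forall>u\<in>I. y' u = 0) \<or> (\<exists>C. \<forall>u\<in>I. x' u = (y u ^ 4 / 4 + C) * y' u)"
proof (cases "\<forall>u\<in>I. y' u = 0")
  case False
  then obtain w where w: "w \<in> I" "y' w \<noteq> 0"
    by blast
  define C where "C = x' w / y' w - y w ^ 4 / 4"
  define S where "S = {u \<in> I. x' u - (y u ^ 4 / 4 + C) * y' u = 0}"
  have cont: "continuous_on I y" "continuous_on I x'" "continuous_on I y'"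
    using dy dx' dy' by (meson DERIV_continuous_on has_field_derivative_at_within)+
  have "w \<in> S"
    using w by (simp add: S_def C_def)
  have "closedin (top_of_set I) S"
    unfolding S_def by (intro continuous_closedin_preimage_constant continuous_intros cont) auto
  moreover have "open S"
  proof (rule openI)
    fix u assume "u \<in> S"
    then have u: "u \<in> I" "x' u = (y u ^ 4 / 4 + C) * y' u"
      by (auto simp: S_def)
    then have "y' u \<noteq> 0"
      using regular by force
    moreover have "open (I \<inter> y' -` (- {0}))"
      using cont(3) I(1) by (intro continuous_open_preimage) auto
    ultimately obtain e where e: "e > 0" "ball u e \<subseteq> I \<inter> y' -` (- {0})"
      using u(1) by (metis Compl_iff IntI empty_iff insert_iff open_contains_ball vimageI)
    have "\<exists>c. \<forall>t\<in>ball u e. x' t / y' t - y t ^ 4 / 4 = c"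
    proof (rule zero_deriv_constant)
      fix t assume "t \<in> ball u e"
      then have t: "t \<in> I" "y' t \<noteq> 0"
        using e by auto
      have "(x'' t * y' t - x' t * y'' t) / (y' t * y' t) = y t ^ 3 * y' t"
        unfolding ode[OF t(1)] using t(2) by (simp add: power_mult_distrib power3_eq_cube)
      then show "((\<lambda>t. x' t / y' t - y t ^ 4 / 4) has_real_derivative 0) (at t)"
        by (auto intro!: derivative_eq_intros dx' dy' dy t simp: t(2))
    qed auto
    then obtain c where c: "\<And>t. t \<in> ball u e \<Longrightarrow> x' t / y' t - y t ^ 4 / 4 = c"
      by blast
    have "c = C"
      using c[of u] e u(2) \<open>y' u \<noteq> 0\<close> by auto
    have "t \<in> S" if "t \<in> ball u e" for t
    proof -
      have t: "t \<in> I" "y' t \<noteq> 0"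
        using e that by auto
      then show ?thesis
        using c[OF that] \<open>c = C\<close> by (auto simp: S_def field_simps)
    qed
    then show "\<exists>e>0. ball u e \<subseteq> S"
      using e(1) by blast
  qed
  then have "openin (top_of_set I) S"
    by (simp add: S_def open_subset)
  ultimately have "S = I"
    using I(2) \<open>w \<in> S\<close> unfolding connected_clopen by blast
  then show ?thesis
    by (auto simp: S_def)
qed auto

section \<open>Solutions lie on lines or quintics\<close>

lemma quintic_coordinate_velocity:
  assumes "immersed_curve I Y" "u \<in> I"
    and quintic: "\<And>u. u \<in> I \<Longrightarrow> Y u $ 1 = 1/20 * (Y u $ 2) ^ 5 + C1 * Y u $ 2 + C2"
  shows "vderiv Y u $ 1 = ((Y u $ 2) ^ 4 / 4 + C1) * vderiv Y u $ 2"
proof (rule DERIV_unique)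
  have I: "open I" "smooth_on I Y"
    using assms(1) by (auto simp: immersed_curve_def)
  show "((\<lambda>u. Y u $ 1) has_real_derivative vderiv Y u $ 1) (at u)"
    by (rule smooth_coordinate_derivs(1)[OF I(2) assms(2)])
  have "((\<lambda>u. 1/20 * (Y u $ 2) ^ 5 + C1 * Y u $ 2 + C2) has_real_derivative
      ((Y u $ 2) ^ 4 / 4 + C1) * vderiv Y u $ 2) (at u)"
    by (auto intro!: derivative_eq_intros smooth_coordinate_derivs[OF I(2) assms(2)]
        simp: algebra_simps)
  then show "((\<lambda>u. Y u $ 1) has_real_derivative ((Y u $ 2) ^ 4 / 4 + C1) * vderiv Y u $ 2) (at u)"
    by (rule has_field_derivative_transform_within_open[OF _ I(1) assms(2)]) (simp add: quintic)
qed

lemma horizontal_velocity: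
  assumes "immersed_curve I Y" "u \<in> I" "\<And>u. u \<in> I \<Longrightarrow> Y u $ 2 = C"
  shows "vderiv Y u $ 2 = 0"
proof (rule DERIV_unique)
  have I: "open I" "smooth_on I Y"
    using assms(1) by (auto simp: immersed_curve_def)
  show "((\<lambda>u. Y u $ 2) has_real_derivative vderiv Y u $ 2) (at u)"
    by (rule smooth_coordinate_derivs(1)[OF I(2) assms(2)])
  show "((\<lambda>u. Y u $ 2) has_real_derivative 0) (at u)"
    by (rule has_field_derivative_transform_within_open[OF DERIV_const I(1) assms(2)])
      (simp add: assms(3))
qed

text \<open>
  Since membership in the curve \<open>y = C\<close> or \<open>x = y\<^sup>5/20 + C\<^sub>1 y + C\<^sub>2\<close> is a condition on points, this form of
  the classification does not depend on the parametrization. It thus applies at once to a given curve, to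
  the full lines and quintics, and to any solution extending a given one.
\<close>

lemma solution_iff_line_or_quintic:
  "solution I Y \<longleftrightarrow> immersed_curve I Y \<and>
     ((\<exists>C. \<forall>u\<in>I. Y u $ 2 = C) \<or>
      (\<exists>C1 C2. \<forall>u\<in>I. Y u $ 1 = 1/20 * (Y u $ 2) ^ 5 + C1 * Y u $ 2 + C2))"
  (is "_ \<longleftrightarrow> _ \<and> (?line \<or> ?quintic)")
proof (cases "immersed_curve I Y")
  case True
  then have I: "open I" "connected I" "smooth_on I Y"
    by (auto simp: immersed_curve_def)
  note derivs = smooth_coordinate_derivs[OF I(3)]
  have "?line \<or> ?quintic" if "solution I Y"
  proof -
    have "(\<forall>u\<in>I. vderiv Y u $ 2 = 0) \<or>
        (\<exists>C. \<forall>u\<in>I. vderiv Y u $ 1 = ((Y u $ 2) ^ 4 / 4 + C) * vderiv Y u $ 2)"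
      using that immersed_coordinates_nonzero[OF True] unfolding solution_iff_ode
      by (intro slope_ode_dichotomy[OF I(1,2) derivs(1) derivs(2) derivs(2)]) auto
    then show ?thesis
    proof (elim disjE exE)
      assume "\<forall>u\<in>I. vderiv Y u $ 2 = 0"
      then have ?line
        using derivs(1)[of _ 2] by (intro zero_deriv_constant[OF I(1,2)]) auto
      then show ?thesis ..
    next
      fix C assume C: "\<forall>u\<in>I. vderiv Y u $ 1 = ((Y u $ 2) ^ 4 / 4 + C) * vderiv Y u $ 2"
      have "\<exists>c. \<forall>u\<in>I. Y u $ 1 - (1/20 * (Y u $ 2) ^ 5 + C * Y u $ 2) = c"
        using C by (intro zero_deriv_constant[OF I(1,2)])
          (auto intro!: derivative_eq_intros derivs(1) simp: algebra_simps)
      then obtain c where "\<forall>u\<in>I. Y u $ 1 = 1/20 * (Y u $ 2) ^ 5 + C * Y u $ 2 + c"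
        by (auto simp: algebra_simps)
      then show ?thesis
        by blast
    qed
  qed
  moreover have "solution I Y" if ?line
  proof -
    from that obtain C where C: "\<And>u. u \<in> I \<Longrightarrow> Y u $ 2 = C"
      by blast
    have y': "vderiv Y u $ 2 = 0" if "u \<in> I" for u
      by (rule horizontal_velocity[OF True that C])
    have "vderiv (vderiv Y) u $ 2 = 0" if "u \<in> I" for u
    proof (rule DERIV_unique)
      show "((\<lambda>u. vderiv Y u $ 2) has_real_derivative vderiv (vderiv Y) u $ 2) (at u)"
        by (rule derivs(2)[OF that])
      show "((\<lambda>u. vderiv Y u $ 2) has_real_derivative 0) (at u)"
        by (rule has_field_derivative_transform_within_open[OF DERIV_const I(1) that])
          (simp add: y')
    qed
    with y' show ?thesis
      by (simp add: solution_iff_ode True)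
  qed
  moreover have "solution I Y" if ?quintic
  proof -
    from that obtain C1 C2
      where C: "\<And>u. u \<in> I \<Longrightarrow> Y u $ 1 = 1/20 * (Y u $ 2) ^ 5 + C1 * Y u $ 2 + C2"
      by blast
    have x': "vderiv Y u $ 1 = ((Y u $ 2) ^ 4 / 4 + C1) * vderiv Y u $ 2" if "u \<in> I" for u
      by (rule quintic_coordinate_velocity[OF True that C])
    have x'': "vderiv (vderiv Y) u $ 1 = (Y u $ 2) ^ 3 * (vderiv Y u $ 2)\<^sup>2
        + ((Y u $ 2) ^ 4 / 4 + C1) * vderiv (vderiv Y) u $ 2" (is "_ = ?D") if "u \<in> I" for u
    proof (rule DERIV_unique)
      show "((\<lambda>u. vderiv Y u $ 1) has_real_derivative vderiv (vderiv Y) u $ 1) (at u)"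
        by (rule derivs(2)[OF that])
      have "((\<lambda>u. ((Y u $ 2) ^ 4 / 4 + C1) * vderiv Y u $ 2) has_real_derivative ?D) (at u)"
        by (auto intro!: derivative_eq_intros derivs[OF that]
            simp: algebra_simps power2_eq_square)
      then show "((\<lambda>u. vderiv Y u $ 1) has_real_derivative ?D) (at u)"
        by (rule has_field_derivative_transform_within_open[OF _ I(1) that]) (simp add: x')
    qed
    have "vderiv (vderiv Y) u $ 1 * vderiv Y u $ 2 - vderiv Y u $ 1 * vderiv (vderiv Y) u $ 2
          = (Y u $ 2 * vderiv Y u $ 2) ^ 3" if "u \<in> I" for u
      unfolding x'[OF that] x''[OF that]
      by (simp add: power_mult_distrib power2_eq_square power3_eq_cube algebra_simps)
    then show ?thesis
      by (simp add: solution_iff_ode True)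
  qed
  ultimately show ?thesis
    using True by blast
qed (simp add: solution_def)

lemma inj_on_coordinate:
  assumes "immersed_curve I Y" "\<And>u. u \<in> I \<Longrightarrow> vderiv Y u $ i \<noteq> 0"
  shows "inj_on (\<lambda>u. Y u $ i) I"
proof (rule inj_on_nonzero_deriv)
  show "connected I"
    using assms(1) by (simp add: immersed_curve_def)
  show "((\<lambda>u. Y u $ i) has_real_derivative vderiv Y t $ i) (at t)" if "t \<in> I" for t
    using assms(1) that by (intro smooth_coordinate_derivs) (auto simp: immersed_curve_def)
qed (use assms(2) in auto)

section \<open>Maximal solutions\<close>

lemma line_velocity_nonzero:
  assumes "immersed_curve I Y" "\<And>u. u \<in> I \<Longrightarrow> Y u $ 2 = C" "u \<in> I"
  shows "vderiv Y u $ 1 \<noteq> 0"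
  using horizontal_velocity[OF assms(1,3,2)] immersed_coordinates_nonzero[OF assms(1,3)] by auto

lemma quintic_velocity_nonzero:
  assumes "immersed_curve I Y"
    and "\<And>u. u \<in> I \<Longrightarrow> Y u $ 1 = 1/20 * (Y u $ 2) ^ 5 + C1 * Y u $ 2 + C2" "u \<in> I"
  shows "vderiv Y u $ 2 \<noteq> 0"
  using quintic_coordinate_velocity[OF assms(1,3,2)] immersed_coordinates_nonzero[OF assms(1,3)]
  by auto

lemma immersed_horizontal_line: "immersed_curve UNIV (horizontal_line C)"
proof -
  have eq: "horizontal_line C = (\<lambda>s. vector [poly [:0, 1:] s, poly [:C:] s])"
    by (simp add: horizontal_line_def fun_eq_iff)
  have "vderiv (horizontal_line C) u $ 1 = 1" for u
    unfolding eq vderiv_eqI[OF has_vector_derivative_planar_poly] by (simp add: pderiv_pCons)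
  then have "vderiv (horizontal_line C) u \<noteq> 0" for u
    by (metis zero_index zero_neq_one)
  moreover have "smooth_on UNIV (horizontal_line C)"
    unfolding eq by (rule smooth_on_planar_poly)
  ultimately show ?thesis
    by (simp add: immersed_curve_def)
qed

lemma immersed_quintic_curve: "immersed_curve UNIV (quintic_curve C1 C2)"
proof -
  have eq: "quintic_curve C1 C2 = (\<lambda>s. vector [poly [:C2, C1, 0, 0, 0, 1/20:] s, poly [:0, 1:] s])"
    by (simp add: quintic_curve_def fun_eq_iff algebra_simps power_numeral_reduce)
  have "vderiv (quintic_curve C1 C2) u $ 2 = 1" for u
    unfolding eq vderiv_eqI[OF has_vector_derivative_planar_poly] by (simp add: pderiv_pCons)
  then have "vderiv (quintic_curve C1 C2) u \<noteq> 0" for u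
    by (metis zero_index zero_neq_one)
  moreover have "smooth_on UNIV (quintic_curve C1 C2)"
    unfolding eq by (rule smooth_on_planar_poly)
  ultimately show ?thesis
    by (simp add: immersed_curve_def)
qed

text \<open>
  The coordinate itself is the change of parameter: in the full line and the full quintic the
  parameter is the \<open>x\<close>-coordinate and the \<open>y\<close>-coordinate, respectively.
\<close>

lemma curve_embedding_coordinate:
  assumes Y: "immersed_curve I Y" and Z: "immersed_curve UNIV Z"
    and nz: "\<And>u. u \<in> I \<Longrightarrow> vderiv Y u $ i \<noteq> 0"
    and eq: "\<And>u. u \<in> I \<Longrightarrow> Y u = Z (Y u $ i)"
  shows "curve_embedding (\<lambda>u. Y u $ i) I Y UNIV Z"
proof -
  have I: "open I" "smooth_on I Y"
    using Y by (auto simp: immersed_curve_def)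
  have "vderiv (\<lambda>u. Y u $ i) u = vderiv Y u $ i" if "u \<in> I" for u
    using smooth_coordinate_derivs(1)[OF I(2) that]
    by (intro vderiv_eqI) (simp add: has_real_derivative_iff_has_vector_derivative)
  then show ?thesis
    unfolding curve_embedding_def
    using Y Z nz smooth_on_coordinate[OF I] inj_on_coordinate[OF Y nz] by (auto intro: eq)
qed

lemma maximal_solution_fills:
  assumes "maximal_solution I Y" "solution UNIV Z" "curve_embedding \<phi> I Y UNIV Z"
  shows "reparametrization I Y UNIV Z"
proof -
  have "\<phi> ` I = UNIV"
    using assms by (simp add: maximal_solution_def)
  with assms(3) show ?thesis
    unfolding reparametrization_def by (intro exI[of _ \<phi>]) simp
qed

text \<open>
  If \<open>Y\<close> already takes all real values in a coordinate that is injective on the larger curve \<open>Z\<close>,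
  then every parameter of \<open>Z\<close> has the same coordinate as the image of some parameter of \<open>Y\<close>, and
  injectivity makes the two parameters equal.
\<close>

lemma embedding_onto_if_coordinate_surj:
  assumes emb: "curve_embedding \<phi> I Y K Z"
    and surj: "(\<lambda>u. Y u $ i) ` I = UNIV"
    and inj: "inj_on (\<lambda>u. Z u $ i) K"
  shows "\<phi> ` I = K"
proof
  show "\<phi> ` I \<subseteq> K"
    using emb by (simp add: curve_embedding_def)
  show "K \<subseteq> \<phi> ` I"
  proof
    fix k assume k: "k \<in> K"
    have "Z k $ i \<in> (\<lambda>u. Y u $ i) ` I"
      unfolding surj by simp
    then obtain u where u: "u \<in> I" "Z k $ i = Y u $ i"
      by auto
    have "\<phi> u \<in> K" "Z (\<phi> u) $ i = Z k $ i"
      using emb u by (auto simp: curve_embedding_def)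
    then have "\<phi> u = k"
      using inj k by (auto dest: inj_onD)
    with u show "k \<in> \<phi> ` I"
      by blast
  qed
qed

lemma maximal_line:
  assumes "reparametrization I Y UNIV (horizontal_line C)"
  shows "maximal_solution I Y"
proof -
  obtain \<psi> where \<psi>: "curve_embedding \<psi> I Y UNIV (horizontal_line C)" "\<psi> ` I = UNIV"
    using assms by (auto simp: reparametrization_def)
  then have Y: "immersed_curve I Y" "\<And>u. u \<in> I \<Longrightarrow> Y u $ 1 = \<psi> u" "\<And>u. u \<in> I \<Longrightarrow> Y u $ 2 = C"
    by (auto simp: curve_embedding_def horizontal_line_def)
  have surj: "(\<lambda>u. Y u $ 1) ` I = UNIV"
    using Y(2) \<psi>(2) by simp
  have "\<phi> ` I = K" if Z: "solution K Z" "curve_embedding \<phi> I Y K Z" for K Z \<phi>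
  proof -
    have Z': "immersed_curve K Z" "\<And>u. u \<in> I \<Longrightarrow> \<phi> u \<in> K" "\<And>u. u \<in> I \<Longrightarrow> Z (\<phi> u) = Y u"
      using Z(2) by (auto simp: curve_embedding_def)
    consider (line) D where "\<And>k. k \<in> K \<Longrightarrow> Z k $ 2 = D"
      | (quintic) D1 D2 where "\<And>k. k \<in> K \<Longrightarrow> Z k $ 1 = 1/20 * (Z k $ 2) ^ 5 + D1 * Z k $ 2 + D2"
      using Z(1) unfolding solution_iff_line_or_quintic by blast
    then show ?thesis
    proof cases
      case line
      show ?thesis
        using inj_on_coordinate[OF Z'(1) line_velocity_nonzero[OF Z'(1) line]]
        by (intro embedding_onto_if_coordinate_surj[OF Z(2) surj]) auto
    next
      case quintic
      \<comment> \<open>A quintic meets the line in a single point, whereas \<open>Y\<close> covers the line.\<close>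
      have "Y u $ 1 = 1/20 * C ^ 5 + D1 * C + D2" if "u \<in> I" for u
        using quintic[OF Z'(2)[OF that]] Z'(3)[OF that] Y(3)[OF that] by simp
      then have "(\<lambda>u. Y u $ 1) ` I \<subseteq> {1/20 * C ^ 5 + D1 * C + D2}"
        by auto
      then have "finite (UNIV :: real set)"
        unfolding surj by (rule finite_subset) simp
      then show ?thesis
        by (simp add: infinite_UNIV_char_0)
    qed
  qed
  moreover have "solution I Y"
    unfolding solution_iff_line_or_quintic
    by (intro conjI disjI1 exI[of _ C]) (simp_all add: Y(1,3))
  ultimately show ?thesis
    unfolding maximal_solution_def by blast
qed

lemma maximal_quintic:
  assumes "reparametrization I Y UNIV (quintic_curve C1 C2)"
  shows "maximal_solution I Y"
proof -
  obtain \<psi> where \<psi>: "curve_embedding \<psi> I Y UNIV (quintic_curve C1 C2)" "\<psi> ` I = UNIV"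
    using assms by (auto simp: reparametrization_def)
  then have Y: "immersed_curve I Y" "\<And>u. u \<in> I \<Longrightarrow> Y u $ 2 = \<psi> u"
      "\<And>u. u \<in> I \<Longrightarrow> Y u $ 1 = 1/20 * (Y u $ 2) ^ 5 + C1 * Y u $ 2 + C2"
    by (auto simp: curve_embedding_def quintic_curve_def)
  have surj: "(\<lambda>u. Y u $ 2) ` I = UNIV"
    using Y(2) \<psi>(2) by simp
  have "\<phi> ` I = K" if Z: "solution K Z" "curve_embedding \<phi> I Y K Z" for K Z \<phi>
  proof -
    have Z': "immersed_curve K Z" "\<And>u. u \<in> I \<Longrightarrow> \<phi> u \<in> K" "\<And>u. u \<in> I \<Longrightarrow> Z (\<phi> u) = Y u"
      using Z(2) by (auto simp: curve_embedding_def)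
    consider (line) D where "\<And>k. k \<in> K \<Longrightarrow> Z k $ 2 = D"
      | (quintic) D1 D2 where "\<And>k. k \<in> K \<Longrightarrow> Z k $ 1 = 1/20 * (Z k $ 2) ^ 5 + D1 * Z k $ 2 + D2"
      using Z(1) unfolding solution_iff_line_or_quintic by blast
    then show ?thesis
    proof cases
      case line
      have "Y u $ 2 = D" if "u \<in> I" for u
        using line[OF Z'(2)[OF that]] Z'(3)[OF that] by simp
      then have "(\<lambda>u. Y u $ 2) ` I \<subseteq> {D}"
        by auto
      then have "finite (UNIV :: real set)"
        unfolding surj by (rule finite_subset) simp
      then show ?thesis
        by (simp add: infinite_UNIV_char_0)
    next
      case quintic
      show ?thesis
        using inj_on_coordinate[OF Z'(1) quintic_velocity_nonzero[OF Z'(1) quintic]]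
        by (intro embedding_onto_if_coordinate_surj[OF Z(2) surj]) auto
    qed
  qed
  moreover have "solution I Y"
    unfolding solution_iff_line_or_quintic
    by (intro conjI disjI2 exI[of _ C1] exI[of _ C2]) (simp_all add: Y(1,3))
  ultimately show ?thesis
    unfolding maximal_solution_def by blast
qed

theorem theorem3p6:
  fixes I :: "real set" and Y :: "real \<Rightarrow> real^2"
  shows "maximal_solution I Y \<longleftrightarrow>
    (\<exists>C. reparametrization I Y UNIV (horizontal_line C)) \<or>
    (\<exists>C1 C2. reparametrization I Y UNIV (quintic_curve C1 C2))"
proof
  assume max: "maximal_solution I Y"
  then have "solution I Y"
    by (simp add: maximal_solution_def)
  then have Y: "immersed_curve I Y"
    by (simp add: solution_def)
  consider (line) C where "\<And>u. u \<in> I \<Longrightarrow> Y u $ 2 = C"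
    | (quintic) C1 C2 where "\<And>u. u \<in> I \<Longrightarrow> Y u $ 1 = 1/20 * (Y u $ 2) ^ 5 + C1 * Y u $ 2 + C2"
    using \<open>solution I Y\<close> unfolding solution_iff_line_or_quintic by blast
  then show "(\<exists>C. reparametrization I Y UNIV (horizontal_line C)) \<or>
    (\<exists>C1 C2. reparametrization I Y UNIV (quintic_curve C1 C2))"
  proof cases
    case line
    have "solution UNIV (horizontal_line C)"
      unfolding solution_iff_line_or_quintic
      using immersed_horizontal_line by (auto simp: horizontal_line_def)
    moreover have "curve_embedding (\<lambda>u. Y u $ 1) I Y UNIV (horizontal_line C)"
      using line line_velocity_nonzero[OF Y line]
      by (intro curve_embedding_coordinate[OF Y immersed_horizontal_line])
        (auto simp: horizontal_line_def vec_eq_iff forall_2)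
    ultimately show ?thesis
      using maximal_solution_fills[OF max] by blast
  next
    case quintic
    have "solution UNIV (quintic_curve C1 C2)"
      unfolding solution_iff_line_or_quintic
      using immersed_quintic_curve by (auto simp: quintic_curve_def)
    moreover have "curve_embedding (\<lambda>u. Y u $ 2) I Y UNIV (quintic_curve C1 C2)"
      using quintic quintic_velocity_nonzero[OF Y quintic]
      by (intro curve_embedding_coordinate[OF Y immersed_quintic_curve])
        (auto simp: quintic_curve_def vec_eq_iff forall_2)
    ultimately show ?thesis
      using maximal_solution_fills[OF max] by blast
  qed
qed (use maximal_line maximal_quintic in blast)

end
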